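(* Let $N\ge 2$. Suppose that $q_k:X_{k,2}\to[0,\infty)$ is a rate function for each $k=2,\dots,N$ and that $q_2,\dots,q_N$ is increasing. If $$\gamma^{\mathrm{RW}}_N(q_N)=\min_{2\le k\le N}\gamma^{\mathrm{RW}}_k(q_k),$$ then $q_N$ satisfies Aldous's condition, and $$\min_{2\le k\le N}\gamma^{\mathrm{IP}}_k(q_k)=\gamma^{\mathrm{IP}}_N(q_N)=\gamma^{\mathrm{RW}}_N(q_N).$$
   Context: For $k\ge2$, let $X_k=\{1,\dots,k\}$, let $S_k$ be the group of permutations of $X_k$, and let $X_{k,2}=\{\{i,j\}:1\le i<j\le k\}$. A rate function is a function $q:X_{k,2}\to[0,\infty)$. Let $\ell^2(X_k)$, $\ell^2(S_k)$ be the spaces of complex-valued functions with standard inner products $\langle f,g\rangle=\sum f\overline g$. Write $(i,j)\in S_k$ for the transposition of $i$ and $j$. Define $$(\Omega^{\mathrm{RW}}_k(q)f)(m)=\sum_{\{i,j\}\in X_{k,2}}q(\{i,j\})\big[f((i,j)(m))-f(m)\big],\quad f\in\ell^2(X_k),\ m\in X_k,$$ $$(\Omega^{\mathrm{IP}}_k(q)f)(\pi)=\sum_{\{i,j\}\in X_{k,2}}q(\{i,j\})\big[f((i,j)\pi)-f(\pi)\big],\quad f\in\ell^2(S_k),\ \pi\in S_k,$$ where $(i,j)\pi$ is the product (composition) in $S_k$. The spectral gaps are $$\gamma^{\mathrm{RW}}_k(q)=\min\{\langle f,-\Omega^{\mathrm{RW}}_k(q)f\rangle: f\in\ell^2(X_k),\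 \|f\|=1,\ \langle f,1\rangle=0\},$$ $$\gamma^{\mathrm{IP}}_k(q)=\min\{\langle f,-\Omega^{\mathrm{IP}}_k(q)f\rangle: f\in\ell^2(S_k),\ \|f\|=1,\ \langle f,1\rangle=0\},$$ where $1$ is the constant function. A rate function $q:X_{k,2}\to[0,\infty)$ satisfies Aldous's condition if $\gamma^{\mathrm{IP}}_k(q)=\gamma^{\mathrm{RW}}_k(q)$. The sequence $q_2,\dots,q_N$ is increasing if $q_{k+1}(\{i,j\})\ge q_k(\{i,j\})$ for all $1\le i<j\le k<N$. *)

theory Defs
  imports Complex_Main "HOL-Combinatorics.Permutations"
begin

definition X_pts :: "nat \<Rightarrow> nat set" where
  "X_pts k = {1..k}"

definition S_perms :: "nat \<Rightarrow> (nat \<Rightarrow> nat) set" where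
  "S_perms k = {\<pi>. \<pi> permutes X_pts k}"

definition X_pairs :: "nat \<Rightarrow> nat set set" where
  "X_pairs k = {{i, j} | i j. 1 \<le> i \<and> i < j \<and> j \<le> k}"

(* Only the values of q on X_pairs k matter; a rate function on X_pairs k is represented by a total function
   on nat set. *)
definition rate_function :: "nat \<Rightarrow> (nat set \<Rightarrow> real) \<Rightarrow> bool" where
  "rate_function k q \<longleftrightarrow> (\<forall>e\<in>X_pairs k. 0 \<le> q e)"

definition increasing_rates :: "nat \<Rightarrow> (nat \<Rightarrow> nat set \<Rightarrow> real) \<Rightarrow> bool" where
  "increasing_rates N q \<longleftrightarrow>
     (\<forall>k i j. 2 \<le> k \<and> k < N \<and> 1 \<le> i \<and> i < j \<and> j \<le> k \<longrightarrow> q k {i, j} \<le> q (Suc k) {i, j})"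

(* For e = {i, j} this is the transposition of i and j; Min and Max merely select the two
   elements of e. *)
definition swap :: "nat set \<Rightarrow> nat \<Rightarrow> nat" where
  "swap e = Transposition.transpose (Min e) (Max e)"

definition \<Omega>_RW :: "nat \<Rightarrow> (nat set \<Rightarrow> real) \<Rightarrow> (nat \<Rightarrow> complex) \<Rightarrow> nat \<Rightarrow> complex" where
  "\<Omega>_RW k q f m = (\<Sum>e\<in>X_pairs k. of_real (q e) * (f (swap e m) - f m))"

definition \<Omega>_IP :: "nat \<Rightarrow> (nat set \<Rightarrow> real) \<Rightarrow> ((nat \<Rightarrow> nat) \<Rightarrow> complex) \<Rightarrow> (nat \<Rightarrow> nat) \<Rightarrow> complex" where
  "\<Omega>_IP k q f \<pi> = (\<Sum>e\<in>X_pairs k. of_real (q e) * (f (swap e \<circ> \<pi>) - f \<pi>))"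

definition l2_inner :: "'a set \<Rightarrow> ('a \<Rightarrow> complex) \<Rightarrow> ('a \<Rightarrow> complex) \<Rightarrow> complex" where
  "l2_inner A f g = (\<Sum>x\<in>A. f x * cnj (g x))"

definition l2_norm :: "'a set \<Rightarrow> ('a \<Rightarrow> complex) \<Rightarrow> real" where
  "l2_norm A f = sqrt (Re (l2_inner A f f))"

(* Elements of l2(A) are represented by total functions, whose values outside A enter neither the
   inner product nor (for the operators above) the values of L f on A.  The operators above are
   self-adjoint on l2(A), so the quadratic form is real and Re is only a conversion of type.  The
   minimum is attained because A is finite, so LEAST is well defined whenever A has at least two
   elements. *)
definition spectral_gap :: "'a set \<Rightarrow> (('a \<Rightarrow> complex) \<Rightarrow> 'a \<Rightarrow> complex) \<Rightarrow> real" where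
  "spectral_gap A L =
     (LEAST r. r \<in> {Re (l2_inner A f (\<lambda>x. - L f x)) | f.
                      l2_norm A f = 1 \<and> l2_inner A f (\<lambda>_. 1) = 0})"

definition \<gamma>_RW :: "nat \<Rightarrow> (nat set \<Rightarrow> real) \<Rightarrow> real" where
  "\<gamma>_RW k q = spectral_gap (X_pts k) (\<Omega>_RW k q)"

definition \<gamma>_IP :: "nat \<Rightarrow> (nat set \<Rightarrow> real) \<Rightarrow> real" where
  "\<gamma>_IP k q = spectral_gap (S_perms k) (\<Omega>_IP k q)"

definition Aldous_condition :: "nat \<Rightarrow> (nat set \<Rightarrow> real) \<Rightarrow> bool" where
  "Aldous_condition k q \<longleftrightarrow> \<gamma>_IP k q = \<gamma>_RW k q"

end

theory Submission
  imports Defs "HOL-Analysis.Function_Topology" "HOL-Analysis.Topology_Euclidean_Space"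
begin

text \<open>Let \<open>f\<close> be an eigenfunction of the interchange process on \<open>S_perms (Suc k)\<close> for its spectral gap.
  The sums of \<open>f\<close> over the fibers \<open>\<pi> x = m\<close> form, as a function of \<open>m\<close>, a mean-zero eigenfunction of
  the random walk with the same eigenvalue.  If one of them is nonzero, the gap is at least that of
  the random walk.  Otherwise the fibers \<open>\<pi> x = Suc k\<close> are copies of \<open>S_perms k\<close> on each of which \<open>f\<close> has
  mean zero; dropping the pairs that contain \<open>Suc k\<close> and lowering the other rates, the energy of
  \<open>f\<close> is at least the gap on \<open>S_perms k\<close>.  By induction the gap on \<open>S_perms k\<close> is at least the
  minimum of the random walk gaps up to \<open>k\<close>.  Conversely, a random walk eigenfunction \<open>g\<close> lifts
  to the eigenfunction \<open>\<pi> \<mapsto> g (\<pi> 1)\<close> of the interchange process.\<close>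

section \<open>Compactness, a quadratic inequality and squared norms\<close>

lemma compact_PiE_UNIV:
  fixes S :: "'a \<Rightarrow> 'b::topological_space set"
  assumes "\<And>i. compact (S i)"
  shows "compact (PiE UNIV S)"
proof -
  have "compactin (product_topology (\<lambda>_. euclidean) UNIV) (PiE UNIV S)"
    using assms by (simp add: compactin_PiE)
  then show ?thesis
    by (simp add: euclidean_product_topology)
qed

text \<open>For small negative \<open>t\<close> the linear term outweighs the quadratic one, so a
  positive \<open>a\<close> would violate the inequality. This turns minimality into an eigenvalue
  equation.\<close>

lemma linear_part_zero_of_nonneg:
  fixes a b :: real
  assumes "\<And>t. 0 \<le> 2 * t * a + t\<^sup>2 * b" "0 \<le> a"
  shows "a = 0"
proof (rule ccontr)
  assume "a \<noteq> 0"
  with assms have a: "a > 0" by simp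
  define c where "c = \<bar>b\<bar> + 1"
  have c: "c > 0" "b < c" by (auto simp: c_def)
  \<comment> \<open>At \<open>t = - a / c\<close> the linear term is
    \<open>- 2 * a\<^sup>2 / c\<close>, while \<open>b < c\<close> keeps the quadratic one below
    \<open>a\<^sup>2 / c\<close>.\<close>
  have "0 \<le> 2 * (- a / c) * a + (- a / c)\<^sup>2 * b" by (rule assms)
  also have "\<dots> = (a\<^sup>2 / c) * (b / c - 2)"
    using c(1) by (simp add: power2_eq_square field_simps)
  also have "\<dots> < 0"
  proof (rule mult_pos_neg)
    show "0 < a\<^sup>2 / c" using a c by simp
    have "b / c < 1" using c by simp
    then show "b / c - 2 < 0" by simp
  qed
  finally show False by simp
qed

definition sq_norm :: "'a set \<Rightarrow> ('a \<Rightarrow> complex) \<Rightarrow> real" where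
  "sq_norm A f = (\<Sum>x\<in>A. (cmod (f x))\<^sup>2)"

lemma sq_norm_nonneg: "0 \<le> sq_norm A f"
  by (simp add: sq_norm_def sum_nonneg)

lemma sq_norm_eq_0_iff: "finite A \<Longrightarrow> sq_norm A f = 0 \<longleftrightarrow> (\<forall>x\<in>A. f x = 0)"
  by (simp add: sq_norm_def sum_nonneg_eq_0_iff)

lemma sq_norm_scale: "sq_norm A (\<lambda>x. of_real c * f x) = c\<^sup>2 * sq_norm A f"
  by (simp add: sq_norm_def norm_mult power_mult_distrib sum_distrib_left)

lemma Re_l2_inner_self: "Re (l2_inner A f f) = sq_norm A f"
proof -
  have "l2_inner A f f = of_real (sq_norm A f)"
    by (simp add: l2_inner_def sq_norm_def flip: complex_norm_square)
  then show ?thesis by simp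
qed

lemma l2_norm_eq_1_iff: "l2_norm A f = 1 \<longleftrightarrow> sq_norm A f = 1"
  by (simp add: l2_norm_def Re_l2_inner_self)

lemma cmod_add_scale_sq:
  "(cmod (a + of_real t * b))\<^sup>2 = (cmod a)\<^sup>2 + 2 * t * Re (a * cnj b) + t\<^sup>2 * (cmod b)\<^sup>2"
  unfolding cmod_power2 by (simp add: power2_eq_square algebra_simps)

section \<open>Spectral gaps of symmetric jump processes\<close>

text \<open>Covers transpositions acting on points and transpositions multiplying permutations from
  the left. Jumps that are involutions of \<open>A\<close> make the generator symmetric; two states
  make the set of mean-zero unit functions nonempty.\<close>

locale jump_process =
  fixes A :: "'a set" and E :: "'e set" and q :: "'e \<Rightarrow> real" and s :: "'e \<Rightarrow> 'a \<Rightarrow> 'a"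
  assumes finite_states: "finite A"
    and finite_edges: "finite E"
    and rates_nonneg: "e \<in> E \<Longrightarrow> 0 \<le> q e"
    and jump_in: "e \<in> E \<Longrightarrow> x \<in> A \<Longrightarrow> s e x \<in> A"
    and jump_jump: "e \<in> E \<Longrightarrow> x \<in> A \<Longrightarrow> s e (s e x) = x"
    and two_states: "\<exists>x\<in>A. \<exists>y\<in>A. x \<noteq> y"
begin

definition gen :: "('a \<Rightarrow> complex) \<Rightarrow> 'a \<Rightarrow> complex" where
  "gen f x = (\<Sum>e\<in>E. of_real (q e) * (f (s e x) - f x))"

text \<open>The Dirichlet form of \<open>- gen\<close>; the factor 1/2 compensates for counting each
  jump from both of its ends.\<close>

definition energy :: "('a \<Rightarrow> complex) \<Rightarrow> real" where
  "energy f = (\<Sum>e\<in>E. q e * (\<Sum>x\<in>A. (cmod (f (s e x) - f x))\<^sup>2)) / 2"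

abbreviation gap :: real where
  "gap \<equiv> spectral_gap A gen"

section \<open>Summation by parts and the Dirichlet form\<close>

lemma sum_jump: "e \<in> E \<Longrightarrow> (\<Sum>x\<in>A. g (s e x)) = (\<Sum>x\<in>A. g x)"
  by (rule sum.reindex_bij_witness[of _ "s e" "s e"]) (auto simp: jump_in jump_jump)

lemma sum_gen: "(\<Sum>x\<in>A. gen f x) = 0"
proof -
  have "(\<Sum>x\<in>A. gen f x) = (\<Sum>e\<in>E. of_real (q e) * (\<Sum>x\<in>A. f (s e x) - f x))"
    unfolding gen_def by (subst sum.swap) (simp add: sum_distrib_left)
  also have "\<dots> = 0"
    by (intro sum.neutral) (simp add: sum_subtractf sum_jump)
  finally show ?thesis .
qed

text \<open>Reindexing by the involution \<open>s e\<close> flips the sign of the increment of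
  \<open>f\<close>, so pairing it with \<open>g (s e x)\<close> gives minus its pairing with
  \<open>g x\<close>.\<close>

lemma inner_gen:
  "(\<Sum>x\<in>A. gen f x * cnj (g x)) =
     - (\<Sum>e\<in>E. of_real (q e) * (\<Sum>x\<in>A. (f (s e x) - f x) * cnj (g (s e x) - g x))) / 2"
proof -
  have edge: "(\<Sum>x\<in>A. (f (s e x) - f x) * cnj (g (s e x) - g x)) =
      - 2 * (\<Sum>x\<in>A. (f (s e x) - f x) * cnj (g x))" if e: "e \<in> E" for e
  proof -
    have "(\<Sum>x\<in>A. (f (s e x) - f x) * cnj (g (s e x))) =
        (\<Sum>x\<in>A. (f (s e (s e x)) - f (s e x)) * cnj (g (s e (s e x))))"
      using sum_jump[OF e, of "\<lambda>x. (f (s e x) - f x) * cnj (g (s e x))"] by simp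
    also have "\<dots> = (\<Sum>x\<in>A. - ((f (s e x) - f x) * cnj (g x)))"
      by (intro sum.cong refl) (simp add: jump_jump[OF e] algebra_simps)
    also have "\<dots> = - (\<Sum>x\<in>A. (f (s e x) - f x) * cnj (g x))"
      by (rule sum_negf)
    finally have r: "(\<Sum>x\<in>A. (f (s e x) - f x) * cnj (g (s e x))) =
      - (\<Sum>x\<in>A. (f (s e x) - f x) * cnj (g x))" .
    have "(\<Sum>x\<in>A. (f (s e x) - f x) * cnj (g (s e x) - g x)) =
      (\<Sum>x\<in>A. (f (s e x) - f x) * cnj (g (s e x))) - (\<Sum>x\<in>A. (f (s e x) - f x) * cnj (g x))"
      by (simp only: complex_cnj_diff right_diff_distrib sum_subtractf)
    then show ?thesis unfolding r by simp
  qed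
  have "(\<Sum>x\<in>A. gen f x * cnj (g x)) =
      (\<Sum>e\<in>E. of_real (q e) * (\<Sum>x\<in>A. (f (s e x) - f x) * cnj (g x)))"
    unfolding gen_def sum_distrib_right
    by (subst sum.swap) (simp add: sum_distrib_left mult.assoc)
  also have "\<dots> = - (\<Sum>e\<in>E. of_real (q e) * (- 2 * (\<Sum>x\<in>A. (f (s e x) - f x) * cnj (g x)))) / 2"
    by (simp add: sum_divide_distrib flip: sum_negf)
  also have "\<dots> = - (\<Sum>e\<in>E. of_real (q e) *
      (\<Sum>x\<in>A. (f (s e x) - f x) * cnj (g (s e x) - g x))) / 2"
    by (simp only: edge cong: sum.cong)
  finally show ?thesis .
qed

lemma inner_neg_gen_self: "l2_inner A f (\<lambda>x. - gen f x) = of_real (energy f)"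
proof -
  have "(\<Sum>x\<in>A. gen f x * cnj (f x)) = of_real (- energy f)"
    unfolding inner_gen energy_def
    by (simp del: complex_cnj_diff flip: complex_norm_square)
  moreover have "l2_inner A f (\<lambda>x. - gen f x) = - cnj (\<Sum>x\<in>A. gen f x * cnj (f x))"
    by (simp add: l2_inner_def sum_negf mult.commute)
  ultimately show ?thesis by simp
qed

lemma energy_nonneg: "0 \<le> energy f"
  by (simp add: energy_def sum_nonneg rates_nonneg)

lemma energy_scale: "energy (\<lambda>x. of_real c * f x) = c\<^sup>2 * energy f"
  by (simp add: energy_def norm_mult power_mult_distrib sum_distrib_left mult.left_commute
      flip: right_diff_distrib)

section \<open>The gap as an attained minimum\<close>

lemma gap_eq_Least:
  "gap = (LEAST r. r \<in> {energy f | f. sq_norm A f = 1 \<and> (\<Sum>x\<in>A. f x) = 0})"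
proof -
  have i: "l2_inner A f (\<lambda>_. 1) = (\<Sum>x\<in>A. f x)" for f :: "'a \<Rightarrow> complex"
    by (simp add: l2_inner_def)
  show ?thesis
    unfolding spectral_gap_def inner_neg_gen_self l2_norm_eq_1_iff i by simp
qed

lemma exists_energy_minimizer:
  obtains f where "sq_norm A f = 1" "(\<Sum>x\<in>A. f x) = 0"
    "\<And>g. sq_norm A g = 1 \<Longrightarrow> (\<Sum>x\<in>A. g x) = 0 \<Longrightarrow> energy f \<le> energy g"
proof -
  \<comment> \<open>Compact by Tychonoff. The state type may be infinite, so values off
    \<open>A\<close> are pinned to 0; the bound 1 on each coordinate follows from unit norm.\<close>
  let ?B = "PiE UNIV (\<lambda>x. if x \<in> A then cball 0 1 else {0::complex})"
  let ?C = "{f. sq_norm A f = 1} \<inter> {f. (\<Sum>x\<in>A. f x) = 0}"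
  define trunc :: "('a \<Rightarrow> complex) \<Rightarrow> 'a \<Rightarrow> complex"
    where "trunc f = (\<lambda>x. if x \<in> A then f x else 0)" for f
  have trunc_sums: "sq_norm A (trunc f) = sq_norm A f" "sum (trunc f) A = sum f A"
    "energy (trunc f) = energy f" for f
    by (simp_all add: trunc_def sq_norm_def energy_def jump_in)
  have trunc_in: "trunc f \<in> ?B \<inter> ?C" if "sq_norm A f = 1" "sum f A = 0" for f
  proof -
    have "cmod (f x) \<le> 1" if "x \<in> A" for x
    proof -
      have "(cmod (f x))\<^sup>2 \<le> sq_norm A f"
        unfolding sq_norm_def by (rule member_le_sum) (auto simp: that finite_states)
      with \<open>sq_norm A f = 1\<close> show ?thesis
        by (simp add: abs_square_le_1)
    qed
    then have "trunc f \<in> ?B" by (auto simp: trunc_def)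
    with that show ?thesis by (simp add: trunc_sums)
  qed
  have "compact (?B \<inter> ?C)"
  proof (intro compact_Int_closed compact_PiE_UNIV closed_Int closed_Collect_eq)
    show "compact (if x \<in> A then cball 0 1 else {0::complex})" for x by simp
  qed (simp_all add: sq_norm_def, (intro continuous_intros, simp)+)
  moreover have "?B \<inter> ?C \<noteq> {}"
  proof -
    obtain x y where xy: "x \<in> A" "y \<in> A" "x \<noteq> y" using two_states by blast
    define f :: "'a \<Rightarrow> complex"
      \<comment> \<open>The normalised difference of two point indicators meets both
        constraints.\<close>
      where "f z = of_real (1 / sqrt 2) * ((if z = x then 1 else 0) - (if z = y then 1 else 0))" for z
    have "sum f A = 0"
      using xy finite_states by (simp add: f_def sum_subtractf sum.delta flip: sum_divide_distrib)
    moreover have "sq_norm A f = 1"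
    proof -
      have "(cmod (f z))\<^sup>2 = (if z = x then 1/2 else 0) + (if z = y then 1/2 else 0)" for z
        using xy(3) by (simp add: f_def norm_divide power_divide)
      then show ?thesis
        using xy finite_states by (simp add: sq_norm_def sum.distrib sum.delta)
    qed
    ultimately show ?thesis using trunc_in by blast
  qed
  moreover have "continuous_on (?B \<inter> ?C) energy"
    unfolding energy_def
    by (intro continuous_intros) (auto intro: continuous_on_subset[OF continuous_on_product_coordinates])
  ultimately obtain f where "f \<in> ?B \<inter> ?C" "\<forall>g\<in>?B \<inter> ?C. energy f \<le> energy g"
    using continuous_attains_inf[of "?B \<inter> ?C" energy] by blast
  then have f: "sq_norm A f = 1" "sum f A = 0" "\<And>g. g \<in> ?B \<inter> ?C \<Longrightarrow> energy f \<le> energy g"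
    by blast+
  show thesis
  proof (rule that[OF f(1,2)])
    fix g assume "sq_norm A g = 1" "sum g A = 0"
    then have "energy f \<le> energy (trunc g)" by (intro f(3) trunc_in)
    then show "energy f \<le> energy g" by (simp only: trunc_sums)
  qed
qed

text \<open>Since a minimiser exists, the \<open>LEAST\<close> over the reals is a genuine minimum
  rather than an unspecified value.\<close>

lemma gap_attained:
  obtains f where "sq_norm A f = 1" "(\<Sum>x\<in>A. f x) = 0" "energy f = gap"
    "\<And>g. sq_norm A g = 1 \<Longrightarrow> (\<Sum>x\<in>A. g x) = 0 \<Longrightarrow> gap \<le> energy g"
proof -
  obtain f where f: "sq_norm A f = 1" "(\<Sum>x\<in>A. f x) = 0"
    "\<And>g. sq_norm A g = 1 \<Longrightarrow> (\<Sum>x\<in>A. g x) = 0 \<Longrightarrow> energy f \<le> energy g"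
    using exists_energy_minimizer by metis
  have "gap = energy f"
    unfolding gap_eq_Least by (rule Least_equality) (use f in auto)
  with f show thesis by (intro that[of f]) auto
qed

text \<open>The Rayleigh inequality. Both sides are homogeneous of degree two, so \<open>f\<close>
  can be normalised; at norm zero, nonnegativity of the energy suffices.\<close>

lemma gap_le_energy:
  assumes "(\<Sum>x\<in>A. f x) = 0"
  shows "gap * sq_norm A f \<le> energy f"
proof (cases "sq_norm A f = 0")
  case True
  then show ?thesis by (simp add: energy_nonneg)
next
  case False
  define c where "c = 1 / sqrt (sq_norm A f)"
  have n: "sq_norm A f > 0" using False sq_norm_nonneg[of A f] by simp
  have c: "c\<^sup>2 = 1 / sq_norm A f" using n by (simp add: c_def power_divide)
  have "gap \<le> energy (\<lambda>x. of_real c * f x)"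
  proof (rule gap_attained)
    fix h assume *: "\<And>g. sq_norm A g = 1 \<Longrightarrow> (\<Sum>x\<in>A. g x) = 0 \<Longrightarrow> gap \<le> energy g"
    show ?thesis
      by (rule *) (use n assms in \<open>simp_all add: sq_norm_scale c flip: sum_distrib_left\<close>)
  qed
  then show ?thesis using n by (simp add: energy_scale c field_simps)
qed

section \<open>First variation of the energy, and eigenfunctions\<close>

lemma sq_norm_add_scale:
  "sq_norm B (\<lambda>x. f x + of_real t * g x) =
     sq_norm B f + 2 * t * Re (\<Sum>x\<in>B. f x * cnj (g x)) + t\<^sup>2 * sq_norm B g"
  by (simp only: sq_norm_def cmod_add_scale_sq sum.distrib sum_distrib_left Re_sum)

lemma energy_add_scale:
  "energy (\<lambda>x. f x + of_real t * g x) =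
     energy f - 2 * t * Re (\<Sum>x\<in>A. gen f x * cnj (g x)) + t\<^sup>2 * energy g"
proof -
  have "(cmod ((f (s e x) + of_real t * g (s e x)) - (f x + of_real t * g x)))\<^sup>2 =
    (cmod (f (s e x) - f x))\<^sup>2 + 2 * t * Re ((f (s e x) - f x) * cnj (g (s e x) - g x)) +
    t\<^sup>2 * (cmod (g (s e x) - g x))\<^sup>2" for e x
    using cmod_add_scale_sq[of "f (s e x) - f x" t "g (s e x) - g x"] by (simp add: algebra_simps)
  then have "energy (\<lambda>x. f x + of_real t * g x) =
    (\<Sum>e\<in>E. q e * ((\<Sum>x\<in>A. (cmod (f (s e x) - f x))\<^sup>2) +
      2 * t * (\<Sum>x\<in>A. Re ((f (s e x) - f x) * cnj (g (s e x) - g x))) +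
      t\<^sup>2 * (\<Sum>x\<in>A. (cmod (g (s e x) - g x))\<^sup>2))) / 2"
    unfolding energy_def by (simp only: sum.distrib sum_distrib_left)
  also have "\<dots> = energy f +
      2 * t * ((\<Sum>e\<in>E. q e * (\<Sum>x\<in>A. Re ((f (s e x) - f x) * cnj (g (s e x) - g x)))) / 2) +
      t\<^sup>2 * energy g"
    unfolding energy_def
    by (simp only: distrib_left sum.distrib add_divide_distrib sum_divide_distrib sum_distrib_left
        times_divide_eq_right mult.left_commute[of "q _"])
  also have "(\<Sum>e\<in>E. q e * (\<Sum>x\<in>A. Re ((f (s e x) - f x) * cnj (g (s e x) - g x)))) / 2 =
      - Re (\<Sum>x\<in>A. gen f x * cnj (g x))"
    unfolding inner_gen by (simp add: Re_divide_numeral)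
  finally show ?thesis by simp
qed

text \<open>The Euler--Lagrange equation of the minimiser, tested against the defect
  \<open>- gen f x - gap * f x\<close> itself, which has mean zero.\<close>

lemma gap_eigenfunction:
  obtains f where "sq_norm A f = 1" "(\<Sum>x\<in>A. f x) = 0"
    "\<And>x. x \<in> A \<Longrightarrow> gen f x = - of_real gap * f x"
proof -
  obtain f where f: "sq_norm A f = 1" "(\<Sum>x\<in>A. f x) = 0" "energy f = gap"
    using gap_attained by metis
  define r where "r x = - gen f x - of_real gap * f x" for x
  have r_sum: "(\<Sum>x\<in>A. r x) = 0"
    by (simp add: r_def sum_subtractf sum_negf sum_gen f(2) flip: sum_distrib_left)
  \<comment> \<open>Testing against \<open>r\<close> itself turns the linear coefficient of the
    variation into the squared norm of the defect.\<close>
  have r_inner: "- Re (\<Sum>x\<in>A. gen f x * cnj (r x)) - gap * Re (\<Sum>x\<in>A. f x * cnj (r x)) = sq_norm A r"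
  proof -
    have "- (\<Sum>x\<in>A. gen f x * cnj (r x)) - of_real gap * (\<Sum>x\<in>A. f x * cnj (r x)) =
        (\<Sum>x\<in>A. r x * cnj (r x))"
      by (simp add: sum_distrib_left sum_subtractf[symmetric] sum_negf[symmetric])
        (simp add: r_def algebra_simps)
    also have "\<dots> = of_real (sq_norm A r)"
      by (simp add: sq_norm_def flip: complex_norm_square)
    finally show ?thesis
      by (auto dest: arg_cong[of _ _ Re])
  qed
  have "0 \<le> 2 * t * sq_norm A r + t\<^sup>2 * (energy r - gap * sq_norm A r)" for t
  proof -
    \<comment> \<open>The perturbed function still has mean zero, so the Rayleigh inequality
      applies; its terms free of \<open>t\<close> cancel because \<open>f\<close> attains the
      gap.\<close>
    have "gap * sq_norm A (\<lambda>x. f x + of_real t * r x) \<le> energy (\<lambda>x. f x + of_real t * r x)"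
      by (rule gap_le_energy) (simp add: sum.distrib f(2) r_sum flip: sum_distrib_left)
    then show ?thesis
      unfolding sq_norm_add_scale energy_add_scale r_inner[symmetric] f
      by (simp add: algebra_simps)
  qed
  then have "sq_norm A r = 0"
    by (rule linear_part_zero_of_nonneg) (rule sq_norm_nonneg)
  then have "r x = 0" if "x \<in> A" for x
    using that by (simp add: sq_norm_eq_0_iff finite_states)
  then have "- gen f x = of_real gap * f x" if "x \<in> A" for x
    using that by (simp add: r_def)
  then have "gen f x = - of_real gap * f x" if "x \<in> A" for x
    using that by (metis minus_minus mult_minus_left)
  with f show thesis by (intro that[of f])
qed

lemma energy_eigenfunction:
  assumes "\<And>x. x \<in> A \<Longrightarrow> gen f x = - of_real l * f x"
  shows "energy f = l * sq_norm A f"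
proof -
  have "complex_of_real (energy f) = l2_inner A f (\<lambda>x. - gen f x)"
    by (simp add: inner_neg_gen_self)
  also have "\<dots> = (\<Sum>x\<in>A. of_real l * (f x * cnj (f x)))"
    by (simp add: l2_inner_def assms cong: sum.cong) (simp add: mult_ac)
  also have "\<dots> = of_real (l * sq_norm A f)"
    by (simp add: sq_norm_def sum_distrib_left flip: complex_norm_square)
  finally show ?thesis using of_real_eq_iff by blast
qed

text \<open>An eigenfunction competes in the Rayleigh inequality; one nonzero value makes its norm
  positive, so the norm can be cancelled.\<close>

lemma gap_le_eigenvalue:
  assumes "\<And>x. x \<in> A \<Longrightarrow> gen f x = - of_real l * f x"
    and "(\<Sum>x\<in>A. f x) = 0" and "x \<in> A" "f x \<noteq> 0"
  shows "gap \<le> l"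
proof -
  have "sq_norm A f \<noteq> 0" using assms by (auto simp: sq_norm_eq_0_iff finite_states)
  then have "sq_norm A f > 0" using sq_norm_nonneg[of A f] by simp
  moreover have "gap * sq_norm A f \<le> l * sq_norm A f"
    using gap_le_energy[OF assms(2)] energy_eigenfunction[OF assms(1)] by simp
  ultimately show ?thesis by simp
qed

end

section \<open>The random walk and the interchange process\<close>

lemma finite_X_pts: "finite (X_pts k)"
  by (simp add: X_pts_def)

lemma finite_X_pairs: "finite (X_pairs k)"
  by (rule finite_subset[of _ "Pow {1..k}"]) (auto simp: X_pairs_def)

lemma X_pairs_mono: "k \<le> l \<Longrightarrow> X_pairs k \<subseteq> X_pairs l"
  by (force simp: X_pairs_def)

lemma swap_permutes: "e \<in> X_pairs k \<Longrightarrow> swap e permutes X_pts k"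
  unfolding X_pairs_def swap_def X_pts_def by (auto intro!: permutes_swap_id)

lemma swap_swap [simp]: "swap e (swap e x) = x"
  by (simp add: swap_def)

lemma swap_comp_swap [simp]: "swap e \<circ> (swap e \<circ> \<pi>) = \<pi>"
  by (auto simp: fun_eq_iff)

lemma finite_S_perms: "finite (S_perms k)"
  by (simp add: S_perms_def X_pts_def finite_permutations)

lemma swap_comp_S_perms: "e \<in> X_pairs k \<Longrightarrow> \<pi> \<in> S_perms k \<Longrightarrow> swap e \<circ> \<pi> \<in> S_perms k"
  by (simp add: S_perms_def permutes_compose swap_permutes)

lemma transpose_comp_S_perms:
  "i \<in> X_pts k \<Longrightarrow> j \<in> X_pts k \<Longrightarrow> \<pi> \<in> S_perms k \<Longrightarrow> Transposition.transpose i j \<circ> \<pi> \<in> S_perms k"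
  by (simp add: S_perms_def permutes_compose permutes_swap_id)

lemma S_perms_comp_transpose:
  "i \<in> X_pts k \<Longrightarrow> j \<in> X_pts k \<Longrightarrow> \<pi> \<in> S_perms k \<Longrightarrow> \<pi> \<circ> Transposition.transpose i j \<in> S_perms k"
  by (simp add: S_perms_def permutes_compose permutes_swap_id)

lemma S_perms_in: "\<pi> \<in> S_perms k \<Longrightarrow> x \<in> X_pts k \<Longrightarrow> \<pi> x \<in> X_pts k"
  by (simp add: S_perms_def permutes_in_image)

lemma id_in_S_perms: "id \<in> S_perms k"
  by (simp add: S_perms_def permutes_id)

lemma jump_process_RW:
  assumes "2 \<le> k" "rate_function k q"
  shows "jump_process (X_pts k) (X_pairs k) q swap"
proof
  show "\<exists>x\<in>X_pts k. \<exists>y\<in>X_pts k. x \<noteq> y"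
    using assms(1) by (intro bexI[of _ 1] bexI[of _ 2]) (auto simp: X_pts_def)
qed (use assms in \<open>auto simp: finite_X_pts finite_X_pairs rate_function_def
  permutes_in_image[OF swap_permutes]\<close>)

lemma jump_process_IP:
  assumes "2 \<le> k" "rate_function k q"
  shows "jump_process (S_perms k) (X_pairs k) q (\<lambda>e \<pi>. swap e \<circ> \<pi>)"
proof
  have "Transposition.transpose 1 2 \<in> S_perms k"
    using assms(1) by (simp add: S_perms_def X_pts_def permutes_swap_id)
  moreover have "Transposition.transpose 1 2 \<noteq> (id :: nat \<Rightarrow> nat)"
    by (metis id_apply transpose_apply_first one_eq_numeral_iff num.distinct(1))
  ultimately show "\<exists>x\<in>S_perms k. \<exists>y\<in>S_perms k. x \<noteq> y"
    using id_in_S_perms by blast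
qed (use assms in \<open>auto simp: finite_S_perms finite_X_pairs rate_function_def swap_comp_S_perms\<close>)

lemma \<gamma>_RW_eq_gap:
  assumes "2 \<le> k" "rate_function k q"
  shows "\<gamma>_RW k q = spectral_gap (X_pts k) (jump_process.gen (X_pairs k) q swap)"
proof -
  have "\<Omega>_RW k q = jump_process.gen (X_pairs k) q swap"
    by (intro ext) (simp add: \<Omega>_RW_def jump_process.gen_def[OF jump_process_RW[OF assms]])
  then show ?thesis by (simp add: \<gamma>_RW_def)
qed

lemma \<gamma>_IP_eq_gap:
  assumes "2 \<le> k" "rate_function k q"
  shows "\<gamma>_IP k q =
    spectral_gap (S_perms k) (jump_process.gen (X_pairs k) q (\<lambda>e \<pi>. swap e \<circ> \<pi>))"
proof -
  have "\<Omega>_IP k q = jump_process.gen (X_pairs k) q (\<lambda>e \<pi>. swap e \<circ> \<pi>)"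
    by (intro ext) (simp add: \<Omega>_IP_def jump_process.gen_def[OF jump_process_IP[OF assms]])
  then show ?thesis by (simp add: \<gamma>_IP_def)
qed

section \<open>Fibers of evaluation maps, and transfer of eigenfunctions between the two
  processes\<close>

lemma sum_over_fibers:
  fixes g :: "(nat \<Rightarrow> nat) \<Rightarrow> 'a::comm_monoid_add"
  assumes "x \<in> X_pts k"
  shows "(\<Sum>m\<in>X_pts k. \<Sum>\<pi> | \<pi> \<in> S_perms k \<and> \<pi> x = m. g \<pi>) = (\<Sum>\<pi>\<in>S_perms k. g \<pi>)"
  by (rule sum.group) (auto simp: finite_S_perms finite_X_pts S_perms_in assms)

text \<open>Left composition with the transposition of \<open>m\<close> and \<open>m'\<close>
  exchanges the two fibers.\<close>

lemma card_fiber_eq: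
  assumes "m \<in> X_pts k" "m' \<in> X_pts k"
  shows "card {\<pi> \<in> S_perms k. \<pi> x = m} = card {\<pi> \<in> S_perms k. \<pi> x = m'}"
proof (rule bij_betw_same_card)
  show "bij_betw (\<lambda>\<pi>. Transposition.transpose m m' \<circ> \<pi>) {\<pi> \<in> S_perms k. \<pi> x = m} {\<pi> \<in> S_perms k. \<pi> x = m'}"
    by (rule bij_betw_byWitness[where f' = "\<lambda>\<pi>. Transposition.transpose m m' \<circ> \<pi>"])
      (use assms in \<open>auto simp: transpose_comp_S_perms fun_eq_iff\<close>)
qed

text \<open>Left multiplication by \<open>swap e\<close> moves \<open>\<pi> 1\<close> exactly as the
  walk jumps, so lifting along evaluation at 1 intertwines the generators.\<close>

lemma \<gamma>_IP_le_\<gamma>_RW: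
  assumes "2 \<le> k" "rate_function k q"
  shows "\<gamma>_IP k q \<le> \<gamma>_RW k q"
proof -
  interpret RW: jump_process "X_pts k" "X_pairs k" q swap
    by (rule jump_process_RW[OF assms])
  interpret IP: jump_process "S_perms k" "X_pairs k" q "\<lambda>e \<pi>. swap e \<circ> \<pi>"
    by (rule jump_process_IP[OF assms])
  obtain f where f: "sq_norm (X_pts k) f = 1" "(\<Sum>m\<in>X_pts k. f m) = 0"
    "\<And>m. m \<in> X_pts k \<Longrightarrow> RW.gen f m = - of_real RW.gap * f m"
    using RW.gap_eigenfunction by metis
  have one: "1 \<in> X_pts k" using assms(1) by (simp add: X_pts_def)
  obtain m where m: "m \<in> X_pts k" "f m \<noteq> 0"
    using f(1) sq_norm_eq_0_iff[OF RW.finite_states, of f] by auto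
  have "IP.gap \<le> RW.gap"
  proof (rule IP.gap_le_eigenvalue[where f = "\<lambda>\<pi>. f (\<pi> 1)"])
    show "IP.gen (\<lambda>\<pi>. f (\<pi> 1)) \<pi> = - of_real RW.gap * f (\<pi> 1)" if "\<pi> \<in> S_perms k" for \<pi>
      using f(3)[OF S_perms_in[OF that one]] by (simp add: IP.gen_def RW.gen_def)
    have "(\<Sum>\<pi>\<in>S_perms k. f (\<pi> 1)) =
        (\<Sum>m\<in>X_pts k. of_nat (card {\<pi> \<in> S_perms k. \<pi> 1 = m}) * f m)"
      by (simp flip: sum_over_fibers[OF one])
    also have "\<dots> = (\<Sum>m\<in>X_pts k. of_nat (card {\<pi> \<in> S_perms k. \<pi> 1 = 1}) * f m)"
      by (intro sum.cong refl arg_cong2[where f = "(*)"] arg_cong[where f = of_nat]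
          card_fiber_eq one)
    also have "\<dots> = 0" by (simp add: f(2) flip: sum_distrib_left)
    finally show "(\<Sum>\<pi>\<in>S_perms k. f (\<pi> 1)) = 0" .
    \<comment> \<open>A permutation sending 1 to \<open>m\<close>, where \<open>f\<close> does not
      vanish, shows that the lift is nonzero.\<close>
    show "Transposition.transpose 1 m \<in> S_perms k"
      using transpose_comp_S_perms[OF one m(1) id_in_S_perms] by simp
    show "f (Transposition.transpose 1 m 1) \<noteq> 0" using m(2) by simp
  qed
  then show ?thesis by (simp add: \<gamma>_IP_eq_gap \<gamma>_RW_eq_gap assms)
qed

text \<open>Summing over the fibers of evaluation at \<open>x\<close> is adjoint to lifting along
  \<open>x\<close> and also intertwines the generators; \<open>nz\<close> makes the resulting
  function on points nonzero.\<close>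

lemma eigenvalue_ge_\<gamma>_RW:
  assumes "2 \<le> k" "rate_function k q"
    and eig: "\<And>\<pi>. \<pi> \<in> S_perms k \<Longrightarrow> \<Omega>_IP k q f \<pi> = - of_real l * f \<pi>"
    and mean: "(\<Sum>\<pi>\<in>S_perms k. f \<pi>) = 0"
    and x: "x \<in> X_pts k" and m: "m \<in> X_pts k"
    and nz: "(\<Sum>\<pi> | \<pi> \<in> S_perms k \<and> \<pi> x = m. f \<pi>) \<noteq> 0"
  shows "\<gamma>_RW k q \<le> l"
proof -
  interpret RW: jump_process "X_pts k" "X_pairs k" q swap
    by (rule jump_process_RW[OF assms(1,2)])
  define F where "F m = (\<Sum>\<pi> | \<pi> \<in> S_perms k \<and> \<pi> x = m. f \<pi>)" for m
  \<comment> \<open>Left multiplication by \<open>swap e\<close> exchanges the fibers over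
    \<open>m\<close> and \<open>swap e m\<close>.\<close>
  have F_swap: "F (swap e m) = (\<Sum>\<pi> | \<pi> \<in> S_perms k \<and> \<pi> x = m. f (swap e \<circ> \<pi>))"
    if "e \<in> X_pairs k" for e m
    unfolding F_def
    by (rule sum.reindex_bij_witness[of _ "\<lambda>\<pi>. swap e \<circ> \<pi>" "\<lambda>\<pi>. swap e \<circ> \<pi>"])
      (auto simp: swap_comp_S_perms that)
  have "RW.gap \<le> l"
  proof (rule RW.gap_le_eigenvalue[where f = F])
    fix m assume "m \<in> X_pts k"
    have "RW.gen F m =
        (\<Sum>e\<in>X_pairs k. \<Sum>\<pi> | \<pi> \<in> S_perms k \<and> \<pi> x = m. of_real (q e) * (f (swap e \<circ> \<pi>) - f \<pi>))"
      by (simp add: RW.gen_def F_swap sum_distrib_left sum_subtractf right_diff_distrib)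
        (simp add: F_def sum_distrib_left)
    also have "\<dots> = (\<Sum>\<pi> | \<pi> \<in> S_perms k \<and> \<pi> x = m. \<Omega>_IP k q f \<pi>)"
      unfolding \<Omega>_IP_def by (rule sum.swap)
    also have "\<dots> = (\<Sum>\<pi> | \<pi> \<in> S_perms k \<and> \<pi> x = m. - of_real l * f \<pi>)"
      by (rule sum.cong) (auto simp: eig)
    also have "\<dots> = - of_real l * F m"
      by (simp only: F_def sum_distrib_left)
    finally show "RW.gen F m = - of_real l * F m" .
  next
    show "(\<Sum>m\<in>X_pts k. F m) = 0"
      unfolding F_def sum_over_fibers[OF x] by (rule mean)
  qed (use m nz in \<open>auto simp: F_def\<close>)
  then show ?thesis by (simp add: \<gamma>_RW_eq_gap assms)
qed

section \<open>Restriction from \<open>Suc k\<close> to \<open>k\<close> points\<close>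

text \<open>Each fiber \<open>\<pi> x = Suc k\<close> is a right coset of the copy of \<open>S_perms k\<close> that fixes \<open>Suc k\<close>,
  and right translations commute with the jumps \<open>\<pi> \<mapsto> swap e \<circ> \<pi>\<close>.\<close>

lemma sum_fiber_eq_sum_S_perms:
  assumes x: "x \<in> X_pts (Suc k)"
  shows "(\<Sum>\<pi> | \<pi> \<in> S_perms (Suc k) \<and> \<pi> x = Suc k. g \<pi>) =
    (\<Sum>\<sigma>\<in>S_perms k. g (\<sigma> \<circ> Transposition.transpose x (Suc k)))"
proof (rule sum.reindex_bij_witness[of _ "\<lambda>\<sigma>. \<sigma> \<circ> Transposition.transpose x (Suc k)"
      "\<lambda>\<pi>. \<pi> \<circ> Transposition.transpose x (Suc k)"])
  have top: "Suc k \<in> X_pts (Suc k)" by (simp add: X_pts_def)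
  have sub: "X_pts k \<subseteq> X_pts (Suc k)" by (auto simp: X_pts_def)
  fix \<sigma> assume \<sigma>: "\<sigma> \<in> S_perms k"
  then have "\<sigma> \<in> S_perms (Suc k)"
    unfolding S_perms_def mem_Collect_eq by (rule permutes_subset) (rule sub)
  moreover have "\<sigma> (Suc k) = Suc k"
    using \<sigma> unfolding S_perms_def mem_Collect_eq by (rule permutes_not_in) (simp add: X_pts_def)
  ultimately show "\<sigma> \<circ> Transposition.transpose x (Suc k) \<in> {\<pi> \<in> S_perms (Suc k). \<pi> x = Suc k}"
    by (simp add: S_perms_comp_transpose x top)
next
  have top: "Suc k \<in> X_pts (Suc k)" by (simp add: X_pts_def)
  fix \<pi> assume \<pi>: "\<pi> \<in> {\<pi> \<in> S_perms (Suc k). \<pi> x = Suc k}"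
  then have "\<pi> \<circ> Transposition.transpose x (Suc k) permutes X_pts (Suc k)"
    using S_perms_comp_transpose[OF x top, of \<pi>] by (simp add: S_perms_def)
  then have "\<pi> \<circ> Transposition.transpose x (Suc k) permutes X_pts k"
  proof (rule permutes_superset)
    fix i assume "i \<in> X_pts (Suc k) - X_pts k"
    then have "i = Suc k" by (auto simp: X_pts_def)
    then show "(\<pi> \<circ> Transposition.transpose x (Suc k)) i = i" using \<pi> by simp
  qed
  then show "\<pi> \<circ> Transposition.transpose x (Suc k) \<in> S_perms k"
    by (simp add: S_perms_def)
qed (simp_all add: comp_assoc)

text \<open>By \<open>zero\<close>, each piece of \<open>f\<close> on a coset is admissible in the
  Rayleigh inequality on \<open>S_perms k\<close>. The squared norms of the pieces add up to that of
  \<open>f\<close>, and their energies to at most that of \<open>f\<close>.\<close>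

lemma \<gamma>_IP_restrict:
  assumes "2 \<le> k" and rates: "rate_function k q" "rate_function (Suc k) q'"
    and incr: "\<And>e. e \<in> X_pairs k \<Longrightarrow> q e \<le> q' e"
    and eig: "\<And>\<pi>. \<pi> \<in> S_perms (Suc k) \<Longrightarrow> \<Omega>_IP (Suc k) q' f \<pi> = - of_real l * f \<pi>"
    and nz: "sq_norm (S_perms (Suc k)) f = 1"
    and zero: "\<And>x. x \<in> X_pts (Suc k) \<Longrightarrow> (\<Sum>\<pi> | \<pi> \<in> S_perms (Suc k) \<and> \<pi> x = Suc k. f \<pi>) = 0"
  shows "\<gamma>_IP k q \<le> l"
proof -
  interpret P: jump_process "S_perms k" "X_pairs k" q "\<lambda>e \<pi>. swap e \<circ> \<pi>"
    by (rule jump_process_IP[OF assms(1,2)])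
  interpret P': jump_process "S_perms (Suc k)" "X_pairs (Suc k)" q' "\<lambda>e \<pi>. swap e \<circ> \<pi>"
    using assms by (intro jump_process_IP) auto
  define fx where "fx x \<sigma> = f (\<sigma> \<circ> Transposition.transpose x (Suc k))" for x \<sigma>
  have split: "(\<Sum>\<pi>\<in>S_perms (Suc k). g \<pi>) =
      (\<Sum>x\<in>X_pts (Suc k). \<Sum>\<sigma>\<in>S_perms k. g (\<sigma> \<circ> Transposition.transpose x (Suc k)))" for g :: "_ \<Rightarrow> real"
  proof -
    \<comment> \<open>Grouping by the preimage of \<open>Suc k\<close> shows that these fibers
      partition the group: here the target is fixed and \<open>x\<close> varies.\<close>
    have "(\<Sum>\<pi>\<in>S_perms (Suc k). g \<pi>) =
        (\<Sum>x\<in>X_pts (Suc k). \<Sum>\<pi> | \<pi> \<in> S_perms (Suc k) \<and> inv \<pi> (Suc k) = x. g \<pi>)"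
    proof (rule sum.group[symmetric])
      show "(\<lambda>\<pi>. inv \<pi> (Suc k)) ` S_perms (Suc k) \<subseteq> X_pts (Suc k)"
        by (auto simp: S_perms_def permutes_in_image[OF permutes_inv]) (simp add: X_pts_def)
    qed (simp_all add: finite_S_perms X_pts_def)
    also have "\<dots> = (\<Sum>x\<in>X_pts (Suc k). \<Sum>\<pi> | \<pi> \<in> S_perms (Suc k) \<and> \<pi> x = Suc k. g \<pi>)"
      by (intro sum.cong refl Collect_cong) (auto simp: S_perms_def permutes_inv_eq permutes_inverses)
    also have "\<dots> = (\<Sum>x\<in>X_pts (Suc k). \<Sum>\<sigma>\<in>S_perms k. g (\<sigma> \<circ> Transposition.transpose x (Suc k)))"
      by (intro sum.cong refl sum_fiber_eq_sum_S_perms)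
    finally show ?thesis .
  qed
  have "P.gap = P.gap * (\<Sum>x\<in>X_pts (Suc k). sq_norm (S_perms k) (fx x))"
    using nz by (simp add: sq_norm_def split fx_def)
  also have "\<dots> = (\<Sum>x\<in>X_pts (Suc k). P.gap * sq_norm (S_perms k) (fx x))"
    by (rule sum_distrib_left)
  also have "\<dots> \<le> (\<Sum>x\<in>X_pts (Suc k). P.energy (fx x))"
    by (intro sum_mono P.gap_le_energy) (simp add: fx_def zero flip: sum_fiber_eq_sum_S_perms)
  \<comment> \<open>Right translation commutes with left multiplication, so the energies of the
    pieces join into sums over all of \<open>S_perms (Suc k)\<close>, for pairs within
    \<open>X_pts k\<close>.\<close>
  also have "\<dots> = (\<Sum>e\<in>X_pairs k. q e *
      (\<Sum>\<pi>\<in>S_perms (Suc k). (cmod (f (swap e \<circ> \<pi>) - f \<pi>))\<^sup>2)) / 2"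
    unfolding P.energy_def fx_def split sum_distrib_left
    by (subst sum.swap) (simp add: comp_assoc flip: sum_divide_distrib)
  also have "\<dots> \<le> (\<Sum>e\<in>X_pairs k. q' e *
      (\<Sum>\<pi>\<in>S_perms (Suc k). (cmod (f (swap e \<circ> \<pi>) - f \<pi>))\<^sup>2)) / 2"
    by (intro divide_right_mono sum_mono mult_right_mono incr) (auto simp: sum_nonneg)
  \<comment> \<open>The pairs containing \<open>Suc k\<close>, restored here, contribute nonnegative
    terms.\<close>
  also have "\<dots> \<le> P'.energy f"
    unfolding P'.energy_def
    by (intro divide_right_mono sum_mono2 X_pairs_mono finite_X_pairs)
      (auto intro!: mult_nonneg_nonneg sum_nonneg P'.rates_nonneg)
  also have "\<dots> = l"
    using P'.energy_eigenfunction[of f l] eig nz by (simp add: \<Omega>_IP_def P'.gen_def)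
  finally show ?thesis by (simp add: \<gamma>_IP_eq_gap assms)
qed

section \<open>Induction on the number of points\<close>

lemma \<gamma>_IP_eigenfunction:
  assumes "2 \<le> k" "rate_function k q"
  obtains f where "sq_norm (S_perms k) f = 1" "(\<Sum>\<pi>\<in>S_perms k. f \<pi>) = 0"
    "\<And>\<pi>. \<pi> \<in> S_perms k \<Longrightarrow> \<Omega>_IP k q f \<pi> = - of_real (\<gamma>_IP k q) * f \<pi>"
proof -
  interpret jump_process "S_perms k" "X_pairs k" q "\<lambda>e \<pi>. swap e \<circ> \<pi>"
    by (rule jump_process_IP[OF assms])
  obtain f where "sq_norm (S_perms k) f = 1" "(\<Sum>\<pi>\<in>S_perms k. f \<pi>) = 0"
    "\<And>\<pi>. \<pi> \<in> S_perms k \<Longrightarrow> gen f \<pi> = - of_real gap * f \<pi>"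
    using gap_eigenfunction by metis
  then show thesis
    by (intro that[of f]) (simp_all add: \<gamma>_IP_eq_gap[OF assms] \<Omega>_IP_def gen_def)
qed

text \<open>A permutation of two points is determined by its value at 1, so the fiber through a
  permutation where \<open>f\<close> is nonzero is a singleton and its sum cannot vanish.\<close>

lemma \<gamma>_RW_2_le_\<gamma>_IP_2:
  assumes "rate_function 2 q"
  shows "\<gamma>_RW 2 q \<le> \<gamma>_IP 2 q"
proof -
  obtain f where f: "sq_norm (S_perms 2) f = 1" "(\<Sum>\<pi>\<in>S_perms 2. f \<pi>) = 0"
    "\<And>\<pi>. \<pi> \<in> S_perms 2 \<Longrightarrow> \<Omega>_IP 2 q f \<pi> = - of_real (\<gamma>_IP 2 q) * f \<pi>"
    using \<gamma>_IP_eigenfunction[OF order_refl assms] by metis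
  obtain \<pi> where \<pi>: "\<pi> \<in> S_perms 2" "f \<pi> \<noteq> 0"
    using f(1) sq_norm_eq_0_iff[OF finite_S_perms, of 2 f] by auto
  have perm: "\<rho> 1 \<in> X_pts 2" "\<rho> 2 \<in> X_pts 2" "\<rho> 1 \<noteq> \<rho> 2" "\<And>i. i \<notin> X_pts 2 \<Longrightarrow> \<rho> i = i"
    if "\<rho> \<in> S_perms 2" for \<rho>
  proof -
    show "\<rho> 1 \<in> X_pts 2" "\<rho> 2 \<in> X_pts 2" using S_perms_in[OF that] by (auto simp: X_pts_def)
    have "inj \<rho>" using that by (auto simp: S_perms_def permutes_inj)
    then show "\<rho> 1 \<noteq> \<rho> 2" by (simp add: inj_eq)
    show "\<rho> i = i" if "i \<notin> X_pts 2" for i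
      using that \<open>\<rho> \<in> S_perms 2\<close> by (auto simp: S_perms_def permutes_not_in)
  qed
  have mem: "i \<in> X_pts 2 \<longleftrightarrow> i = 1 \<or> i = 2" for i by (auto simp: X_pts_def)
  have "\<rho> = \<pi>" if "\<rho> \<in> S_perms 2" "\<rho> 1 = \<pi> 1" for \<rho>
  proof
    fix i
    consider "i = 1" | "i = 2" | "i \<notin> X_pts 2" using mem by blast
    then show "\<rho> i = \<pi> i"
    proof cases
      case 2
      then show ?thesis
        using perm(1-3)[OF that(1)] perm(1-3)[OF \<pi>(1)] that(2) unfolding mem by auto
    next
      case 3
      then show ?thesis using perm(4)[OF that(1)] perm(4)[OF \<pi>(1)] by simp
    qed (use that(2) in simp)
  qed
  then have "{\<rho> \<in> S_perms 2. \<rho> 1 = \<pi> 1} = {\<pi>}" using \<pi>(1) by blast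
  then have "(\<Sum>\<rho> | \<rho> \<in> S_perms 2 \<and> \<rho> 1 = \<pi> 1. f \<rho>) \<noteq> 0"
    using \<pi>(2) by simp
  moreover have "1 \<in> X_pts 2" by (simp add: mem)
  ultimately show ?thesis
    using eigenvalue_ge_\<gamma>_RW[OF order_refl assms f(3,2) _ perm(1)[OF \<pi>(1)]] by blast
qed

text \<open>The two branches of the minimum are the two cases for a gap eigenfunction: some fiber
  over \<open>Suc k\<close> has nonzero sum, or all of them have sum zero.\<close>

lemma \<gamma>_IP_Suc_ge:
  assumes "2 \<le> k" "rate_function k q" "rate_function (Suc k) q'"
    and "\<And>e. e \<in> X_pairs k \<Longrightarrow> q e \<le> q' e"
  shows "min (\<gamma>_RW (Suc k) q') (\<gamma>_IP k q) \<le> \<gamma>_IP (Suc k) q'"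
proof -
  have k: "2 \<le> Suc k" using assms(1) by simp
  obtain f where f: "sq_norm (S_perms (Suc k)) f = 1" "(\<Sum>\<pi>\<in>S_perms (Suc k). f \<pi>) = 0"
    "\<And>\<pi>. \<pi> \<in> S_perms (Suc k) \<Longrightarrow> \<Omega>_IP (Suc k) q' f \<pi> = - of_real (\<gamma>_IP (Suc k) q') * f \<pi>"
    using \<gamma>_IP_eigenfunction[OF k assms(3)] by metis
  show ?thesis
  proof (cases "\<forall>x\<in>X_pts (Suc k). (\<Sum>\<pi> | \<pi> \<in> S_perms (Suc k) \<and> \<pi> x = Suc k. f \<pi>) = 0")
    case True
    then have "\<gamma>_IP k q \<le> \<gamma>_IP (Suc k) q'"
      using \<gamma>_IP_restrict[OF assms f(3,1)] by blast
    then show ?thesis by simp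
  next
    case False
    moreover have "Suc k \<in> X_pts (Suc k)" by (simp add: X_pts_def)
    ultimately have "\<gamma>_RW (Suc k) q' \<le> \<gamma>_IP (Suc k) q'"
      using eigenvalue_ge_\<gamma>_RW[OF k assms(3) f(3,2)] by blast
    then show ?thesis by simp
  qed
qed

theorem corollary3p4:
  fixes N :: nat and q :: "nat \<Rightarrow> nat set \<Rightarrow> real"
  assumes "2 \<le> N"
    and "\<And>k. 2 \<le> k \<Longrightarrow> k \<le> N \<Longrightarrow> rate_function k (q k)"
    and "increasing_rates N q"
    and "\<gamma>_RW N (q N) = (MIN k\<in>{2..N}. \<gamma>_RW k (q k))"
  shows "Aldous_condition N (q N) \<and>
    (MIN k\<in>{2..N}. \<gamma>_IP k (q k)) = \<gamma>_IP N (q N) \<and>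
    \<gamma>_IP N (q N) = \<gamma>_RW N (q N)"
proof -
  have RW_min: "\<gamma>_RW N (q N) \<le> \<gamma>_RW k (q k)" if "2 \<le> k" "k \<le> N" for k
    unfolding assms(4) using that by (intro Min_le) auto
  \<comment> \<open>The fixed bound lies below every walk gap, so it survives both branches of the
    minimum in the induction. All \<open>k\<close> up to \<open>N\<close> are kept because the
    minimum of the interchange gaps needs each of them.\<close>
  have IP_ge: "\<gamma>_RW N (q N) \<le> \<gamma>_IP k (q k)" if "2 \<le> k" "k \<le> N" for k
    using that
  proof (induction k rule: dec_induct)
    case base
    have "\<gamma>_RW N (q N) \<le> \<gamma>_RW 2 (q 2)" using RW_min base by simp
    also have "\<dots> \<le> \<gamma>_IP 2 (q 2)" using assms(2) base by (intro \<gamma>_RW_2_le_\<gamma>_IP_2) simp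
    finally show ?case .
  next
    case (step k)
    have "q k e \<le> q (Suc k) e" if "e \<in> X_pairs k" for e
      using that assms(3) step by (auto simp: X_pairs_def increasing_rates_def)
    then have "min (\<gamma>_RW (Suc k) (q (Suc k))) (\<gamma>_IP k (q k)) \<le> \<gamma>_IP (Suc k) (q (Suc k))"
      using step assms(2) by (intro \<gamma>_IP_Suc_ge) auto
    moreover have "\<gamma>_RW N (q N) \<le> \<gamma>_RW (Suc k) (q (Suc k))" using RW_min step by simp
    ultimately show ?case using step by simp
  qed
  \<comment> \<open>Lifting gives the upper bound, the induction at \<open>k = N\<close> the lower
    one.\<close>
  have eq: "\<gamma>_IP N (q N) = \<gamma>_RW N (q N)"
    by (rule antisym) (use assms(1,2) in \<open>simp_all add: IP_ge \<gamma>_IP_le_\<gamma>_RW\<close>)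
  moreover have "(MIN k\<in>{2..N}. \<gamma>_IP k (q k)) = \<gamma>_IP N (q N)"
  proof (rule Min_eqI)
    show "\<gamma>_IP N (q N) \<in> (\<lambda>k. \<gamma>_IP k (q k)) ` {2..N}"
      using assms(1) by (intro image_eqI[of _ _ N]) auto
  qed (use IP_ge eq in auto)
  ultimately show ?thesis by (simp add: Aldous_condition_def)
qed

end
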